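(* Let $G=(V,E)$ be a finite simple undirected graph (not necessarily connected), and let $G^*$ be the cone of $G$. Then the number $|\mathcal{R}(G)|$ of relaxed legal configurations on $G$ equals the number $\tau(G^* )$ of spanning trees of $G^*$.
   Context: A (chip) configuration on a graph $G=(V,E)$ is a function $C\colon V\to\mathbb{N}$. A vertex $v$ can fire if $C(v)>\deg_G(v)$; firing $v$ replaces $C$ by $C'$ with $C'(v)=C(v)-\deg_G(v)-1$, $C'(u)=C(u)+1$ for every neighbor $u$ of $v$, and $C'(u)=C(u)$ otherwise (one chip goes to each neighbor and one chip is annihilated). A configuration is relaxed if no vertex can fire, i.e. $C(v)\le \deg_G(v)$ for all $v$. A configuration is supercritical if $C(v)>\deg_G(v)$ for every vertex $v$. Reverse-firing a vertex $v$ in a configuration $C'$ is allowed only when every neighbor $u$ of $v$ has $C'(u)\ge 1$, and produces $C$ with $C(v)=C'(v)+\deg_G(v)+1$, $C(u)=C'(u)-1$ for each neighbor $u$ of $v$, and $C(u)=C'(u)$ otherwise. A configuration $C$ is legal if there is a sequence of reverse-firings starting at $C$ and ending at a supercritical configuration. $\mathcal{R}(G)$ denotes the set of relaxed legal configurations on $G$. The cone $G^*$ is obtained from $G$ by adding a new vertex $x$ adjacent to every vertex of $G$. *)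

theory Defs
  imports Main "HOL-Library.FuncSet"
begin

text \<open>A graph is given by a vertex set \<open>V\<close> and a set \<open>E\<close> of two-element subsets of \<open>V\<close>.\<close>

definition simple_graph :: "'a set \<Rightarrow> 'a set set \<Rightarrow> bool" where
  "simple_graph V E \<longleftrightarrow> (\<forall>e\<in>E. e \<subseteq> V \<and> card e = 2)"

definition finite_simple_graph :: "'a set \<Rightarrow> 'a set set \<Rightarrow> bool" where
  "finite_simple_graph V E \<longleftrightarrow> finite V \<and> simple_graph V E"

definition nbrs :: "'a set set \<Rightarrow> 'a \<Rightarrow> 'a set" where
  "nbrs E v = {u. {u, v} \<in> E}"

definition degree :: "'a set set \<Rightarrow> 'a \<Rightarrow> nat" where
  "degree E v = card (nbrs E v)"

definition connected_graph :: "'a set \<Rightarrow> 'a set set \<Rightarrow> bool" where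
  "connected_graph V E \<longleftrightarrow>
     V \<noteq> {} \<and> (\<forall>u\<in>V. \<forall>v\<in>V. (\<lambda>x y. {x, y} \<in> E)\<^sup>*\<^sup>* u v)"

text \<open>A cycle is listed without repeating its first vertex at the end. The length bound
  excludes traversing a single edge back and forth.\<close>

definition is_cycle :: "'a set set \<Rightarrow> 'a list \<Rightarrow> bool" where
  "is_cycle E xs \<longleftrightarrow>
     3 \<le> length xs \<and> distinct xs \<and>
     successively (\<lambda>x y. {x, y} \<in> E) xs \<and> {last xs, hd xs} \<in> E"

definition is_tree :: "'a set \<Rightarrow> 'a set set \<Rightarrow> bool" where
  "is_tree V E \<longleftrightarrow> simple_graph V E \<and> connected_graph V E \<and> (\<nexists>xs. is_cycle E xs)"

text \<open>A spanning subgraph has the same vertex set, so a spanning tree is determined by its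
  set of edges.\<close>

definition spanning_trees :: "'a set \<Rightarrow> 'a set set \<Rightarrow> 'a set set set" where
  "spanning_trees V E = {T. T \<subseteq> E \<and> is_tree V T}"

definition num_spanning_trees :: "'a set \<Rightarrow> 'a set set \<Rightarrow> nat" where
  "num_spanning_trees V E = card (spanning_trees V E)"

text \<open>In the cone, an old vertex \<open>v\<close> becomes \<open>Some v\<close>, and the new vertex is \<open>None\<close>.\<close>

definition cone_verts :: "'a set \<Rightarrow> 'a option set" where
  "cone_verts V = insert None (Some ` V)"

definition cone_edges :: "'a set \<Rightarrow> 'a set set \<Rightarrow> 'a option set set" where
  "cone_edges V E = (\<lambda>e. Some ` e) ` E \<union> (\<lambda>v. {None, Some v}) ` V"


text \<open>Configurations are functions on \<open>V\<close> only; the extensional function space makes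
  counting them meaningful.\<close>

definition configs :: "'a set \<Rightarrow> ('a \<Rightarrow> nat) set" where
  "configs V = V \<rightarrow>\<^sub>E UNIV"

definition can_fire :: "'a set set \<Rightarrow> ('a \<Rightarrow> nat) \<Rightarrow> 'a \<Rightarrow> bool" where
  "can_fire E C v \<longleftrightarrow> C v > degree E v"

definition relaxed :: "'a set \<Rightarrow> 'a set set \<Rightarrow> ('a \<Rightarrow> nat) \<Rightarrow> bool" where
  "relaxed V E C \<longleftrightarrow> (\<forall>v\<in>V. \<not> can_fire E C v)"

definition supercritical :: "'a set \<Rightarrow> 'a set set \<Rightarrow> ('a \<Rightarrow> nat) \<Rightarrow> bool" where
  "supercritical V E C \<longleftrightarrow> (\<forall>v\<in>V. C v > degree E v)"

definition can_reverse_fire :: "'a set set \<Rightarrow> ('a \<Rightarrow> nat) \<Rightarrow> 'a \<Rightarrow> bool" where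
  "can_reverse_fire E C v \<longleftrightarrow> (\<forall>u\<in>nbrs E v. 1 \<le> C u)"

definition reverse_fire :: "'a set set \<Rightarrow> 'a \<Rightarrow> ('a \<Rightarrow> nat) \<Rightarrow> ('a \<Rightarrow> nat)" where
  "reverse_fire E v C = (\<lambda>u. if u = v then C u + degree E v + 1
                             else if u \<in> nbrs E v then C u - 1
                             else C u)"

definition reverse_step :: "'a set \<Rightarrow> 'a set set \<Rightarrow> ('a \<Rightarrow> nat) \<Rightarrow> ('a \<Rightarrow> nat) \<Rightarrow> bool" where
  "reverse_step V E C D \<longleftrightarrow> (\<exists>v\<in>V. can_reverse_fire E C v \<and> D = reverse_fire E v C)"

text \<open>The sequence of reverse-firings may be empty.\<close>

definition legal :: "'a set \<Rightarrow> 'a set set \<Rightarrow> ('a \<Rightarrow> nat) \<Rightarrow> bool" where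
  "legal V E C \<longleftrightarrow> (\<exists>D. (reverse_step V E)\<^sup>*\<^sup>* C D \<and> supercritical V E D)"

definition relaxed_legal_configs :: "'a set \<Rightarrow> 'a set set \<Rightarrow> ('a \<Rightarrow> nat) set" where
  "relaxed_legal_configs V E = {C \<in> configs V. relaxed V E C \<and> legal V E C}"

end

theory Submission
  imports Defs
begin

text \<open>
  Dhar's burning criterion turns legality into a condition on subsets: \<open>C\<close> is legal iff every
  nonempty \<open>A \<subseteq> V\<close> has a vertex \<open>v\<close> holding at least as many chips as it has neighbours in \<open>A\<close>.
  Contract the vertices outside a set \<open>U\<close> to a root. If an edge joins \<open>a \<in> U\<close> to the root, the
  configurations satisfying the criterion on \<open>U\<close> split according to whether \<open>C a\<close> is maximal
  (remove \<open>a\<close> from \<open>U\<close>) or not (delete the edge); the spanning trees split in the same way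
  according to whether they contain the edge. Hence both numbers satisfy the same
  deletion--contraction recursion.
\<close>

section \<open>Deletion and contraction\<close>

text \<open>Connectivity in cut form: for edges with two ends it holds iff \<open>F\<close> joins
  every vertex of \<open>U\<close> to the outside of \<open>U\<close>. Contracting a vertex into the
  root then just means removing it from \<open>U\<close>, with the edge set left alone.\<close>

definition crossed :: "'a set set \<Rightarrow> 'a set \<Rightarrow> bool" where
  "crossed F U \<longleftrightarrow> (\<forall>A\<subseteq>U. A \<noteq> {} \<longrightarrow> (\<exists>e\<in>F. e \<inter> A \<noteq> {} \<and> \<not> e \<subseteq> A))"

text \<open>Spanning trees of the contracted graph: it has \<open>card U\<close> vertices besides
  the root, so the edge count stands in for acyclicity.\<close>

definition rooted_trees :: "'a set set \<Rightarrow> 'a set \<Rightarrow> 'a set set set" where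
  "rooted_trees E U = {F. F \<subseteq> E \<and> card F = card U \<and> crossed F U}"

text \<open>A set \<open>A\<close> violating the condition is a forbidden subconfiguration in
  sandpile language.\<close>

definition burnable :: "'a set set \<Rightarrow> 'a set \<Rightarrow> ('a \<Rightarrow> nat) \<Rightarrow> bool" where
  "burnable E U C \<longleftrightarrow> (\<forall>A\<subseteq>U. A \<noteq> {} \<longrightarrow> (\<exists>v\<in>A. card (nbrs E v \<inter> A) \<le> C v))"

text \<open>Recurrent sandpiles with everything outside \<open>U\<close> as sink. Degrees are taken
  in all of \<open>E\<close>, so edges into the sink count.\<close>

definition burnable_configs :: "'a set set \<Rightarrow> 'a set \<Rightarrow> ('a \<Rightarrow> nat) set" where
  "burnable_configs E U = {C \<in> configs U. (\<forall>v\<in>U. C v < degree E v) \<and> burnable E U C}"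

lemma burnableD:
  "burnable E U C \<Longrightarrow> A \<subseteq> U \<Longrightarrow> A \<noteq> {} \<Longrightarrow> \<exists>v\<in>A. card (nbrs E v \<inter> A) \<le> C v"
  by (simp add: burnable_def)

lemma burnable_subset: "burnable E U C \<Longrightarrow> U' \<subseteq> U \<Longrightarrow> burnable E U' C"
  by (simp add: burnable_def)

lemma burnable_cong: "(\<And>v. v \<in> U \<Longrightarrow> C v = D v) \<Longrightarrow> burnable E U C \<longleftrightarrow> burnable E U D"
  unfolding burnable_def by (metis subsetD)

lemma crossedE:
  assumes "crossed F U" "A \<subseteq> U" "A \<noteq> {}"
  obtains e where "e \<in> F" "e \<inter> A \<noteq> {}" "\<not> e \<subseteq> A"
proof -
  have "\<exists>e\<in>F. e \<inter> A \<noteq> {} \<and> \<not> e \<subseteq> A"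
    using assms(1)[unfolded crossed_def, rule_format, OF assms(2,3)] .
  then show thesis using that by (elim bexE conjE)
qed

lemma crossed_subset: "crossed F U \<Longrightarrow> U' \<subseteq> U \<Longrightarrow> crossed F U'"
  by (simp add: crossed_def)

lemma nbrs_sym: "u \<in> nbrs E v \<longleftrightarrow> v \<in> nbrs E u"
  by (simp add: nbrs_def insert_commute)

lemma finite_nbrs: "finite E \<Longrightarrow> finite (nbrs E v)"
proof -
  assume "finite E"
  have "inj_on (\<lambda>u. {u, v}) (nbrs E v)"
    by (auto simp: inj_on_def doubleton_eq_iff)
  moreover have "(\<lambda>u. {u, v}) ` nbrs E v \<subseteq> E"
    by (auto simp: nbrs_def)
  ultimately show ?thesis
    using \<open>finite E\<close> inj_on_finite by blast
qed

section \<open>Trees inside edge sets that cross every subset\<close>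

lemma crossing_edge:
  assumes "card e = 2" "e \<inter> U \<noteq> {}" "\<not> e \<subseteq> U"
  obtains a b where "e = {a, b}" "a \<in> U" "b \<notin> U"
proof -
  obtain x y where "e = {x, y}"
    using assms(1) by (auto simp: card_2_iff)
  then show thesis
    using assms that[of x y] that[of y x] by (auto simp: insert_commute)
qed

lemma crossed_insert_edge:
  assumes "crossed F (U - {a})" "b \<notin> U"
  shows "crossed (insert {a, b} F) U"
  unfolding crossed_def
proof (intro allI impI)
  fix A assume A: "A \<subseteq> U" "A \<noteq> {}"
  show "\<exists>e\<in>insert {a, b} F. e \<inter> A \<noteq> {} \<and> \<not> e \<subseteq> A"
  proof (cases "a \<in> A")
    case True
    then show ?thesis using A assms(2) by auto
  next
    case False
    then have "A \<subseteq> U - {a}" using A by auto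
    then show ?thesis using A(2) assms(1) unfolding crossed_def by blast
  qed
qed

text \<open>An edge \<open>{a, b}\<close> leaving \<open>U\<close> at \<open>a\<close> is added to a
  tree obtained for \<open>U - {a}\<close>. The last conjunct strengthens the induction: the edges
  of the smaller tree meet \<open>U - {a}\<close>, while \<open>{a, b}\<close> does not, so the
  added edge is new and the count goes up by one.\<close>

lemma crossed_obtain_tree:
  assumes "finite U" "finite F" "\<forall>e\<in>F. card e = 2" "crossed F U"
  shows "\<exists>F'\<subseteq>F. card F' = card U \<and> crossed F' U \<and> (\<forall>f\<in>F'. f \<inter> U \<noteq> {})"
  using assms
proof (induction U rule: finite_psubset_induct)
  case (psubset U)
  show ?case
  proof (cases "U = {}")
    case True
    then show ?thesis by (intro exI[of _ "{}"]) (simp add: crossed_def)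
  next
    case False
    then obtain e where e: "e \<in> F" "e \<inter> U \<noteq> {}" "\<not> e \<subseteq> U"
      using crossedE[OF psubset.prems(3) order_refl] by blast
    then obtain a b where ab: "e = {a, b}" "a \<in> U" "b \<notin> U"
      using crossing_edge psubset.prems(2) by metis
    have "\<exists>F'\<subseteq>F. card F' = card (U - {a}) \<and> crossed F' (U - {a}) \<and> (\<forall>f\<in>F'. f \<inter> (U - {a}) \<noteq> {})"
      using psubset.prems ab crossed_subset[OF psubset.prems(3), of "U - {a}"]
      by (intro psubset.IH) auto
    then obtain F' where F': "F' \<subseteq> F" "card F' = card (U - {a})" "crossed F' (U - {a})"
      "\<forall>f\<in>F'. f \<inter> (U - {a}) \<noteq> {}" by blast
    have "e \<notin> F'" using F'(4) ab by auto
    moreover have "finite F'" using F'(1) psubset.prems(1) finite_subset by auto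
    ultimately have "card (insert e F') = card U"
      using F'(2) card_Suc_Diff1[OF psubset.hyps ab(2)] by simp
    moreover have "crossed (insert e F') U"
      using crossed_insert_edge[OF F'(3) ab(3)] ab(1) by simp
    moreover have "\<forall>f\<in>insert e F'. f \<inter> U \<noteq> {}" using F'(4) e(2) by auto
    ultimately show ?thesis using F'(1) e(1)
      by (intro exI[of _ "insert e F'"]) auto
  qed
qed

lemma crossed_card_le:
  assumes "finite U" "finite F" "\<forall>e\<in>F. card e = 2" "crossed F U"
  shows "card U \<le> card F"
  using crossed_obtain_tree[OF assms] card_mono[OF assms(2)] by metis

text \<open>Excludes loops at the contracted root: a rooted tree contains a tree all of whose edges
  meet \<open>U\<close>, and equal cardinality makes the two coincide.\<close>

lemma rooted_trees_touch:
  assumes "finite U" "finite E" "\<forall>e\<in>E. card e = 2" "F \<in> rooted_trees E U" "f \<in> F"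
  shows "f \<inter> U \<noteq> {}"
proof -
  have F: "F \<subseteq> E" "card F = card U" "crossed F U" "finite F"
    using assms finite_subset by (auto simp: rooted_trees_def)
  obtain F' where F': "F' \<subseteq> F" "card F' = card U" "\<forall>f\<in>F'. f \<inter> U \<noteq> {}"
    using crossed_obtain_tree[OF assms(1) F(4) _ F(3)] assms(3) F(1) by blast
  then have "F' = F" using F by (metis card_subset_eq)
  then show ?thesis using F'(3) assms(5) by simp
qed

section \<open>The two deletion-contraction recursions\<close>

lemma finite_rooted_trees: "finite E \<Longrightarrow> finite (rooted_trees E U)"
  by (rule finite_subset[of _ "Pow E"]) (auto simp: rooted_trees_def)

lemma finite_burnable_configs:
  assumes "finite U"
  shows "finite (burnable_configs E U)"
proof (rule finite_subset)
  show "burnable_configs E U \<subseteq> (\<Pi>\<^sub>E v\<in>U. {..<degree E v})"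
    by (auto simp: burnable_configs_def configs_def)
  show "finite (\<Pi>\<^sub>E v\<in>U. {..<degree E v})"
    using assms by (intro finite_PiE) auto
qed

text \<open>The contraction term may keep the full edge set \<open>E\<close>: for
  \<open>U - {a}\<close> the edge \<open>{a, b}\<close> has become a loop at the root, which no
  rooted tree contains.\<close>

lemma card_rooted_trees_rec:
  assumes "finite U" "finite E" "\<forall>e\<in>E. card e = 2" "{a, b} \<in> E" "a \<in> U" "b \<notin> U"
  shows "card (rooted_trees E U) =
    card (rooted_trees (E - {{a, b}}) U) + card (rooted_trees E (U - {a}))"
proof -
  let ?e = "{a, b}"
  have fin: "finite F" if "F \<subseteq> E" for F using that assms(2) finite_subset by auto
  have notin: "?e \<notin> F" if "F \<in> rooted_trees E (U - {a})" for F
    using rooted_trees_touch[OF _ assms(2,3) that, of ?e] assms(1,6) by auto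
  have "bij_betw (insert ?e) (rooted_trees E (U - {a})) {F \<in> rooted_trees E U. ?e \<in> F}"
  proof (rule bij_betw_byWitness[where f' = "\<lambda>F. F - {?e}"])
    show "\<forall>F\<in>rooted_trees E (U - {a}). insert ?e F - {?e} = F" using notin by auto
    show "\<forall>F\<in>{F \<in> rooted_trees E U. ?e \<in> F}. insert ?e (F - {?e}) = F" by auto
    show "insert ?e ` rooted_trees E (U - {a}) \<subseteq> {F \<in> rooted_trees E U. ?e \<in> F}"
    proof (rule image_subsetI)
      fix F assume F: "F \<in> rooted_trees E (U - {a})"
      then have "F \<subseteq> E" "card F = card (U - {a})" "crossed F (U - {a})"
        by (auto simp: rooted_trees_def)
      then show "insert ?e F \<in> {F \<in> rooted_trees E U. ?e \<in> F}"
        using fin[of F] notin[OF F] assms(4,6) card_Suc_Diff1[OF assms(1,5)]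
          crossed_insert_edge[of F U a b]
        by (simp add: rooted_trees_def)
    qed
    show "(\<lambda>F. F - {?e}) ` {F \<in> rooted_trees E U. ?e \<in> F} \<subseteq> rooted_trees E (U - {a})"
    proof (rule image_subsetI)
      fix F assume "F \<in> {F \<in> rooted_trees E U. ?e \<in> F}"
      then have F: "F \<subseteq> E" "card F = card U" "crossed F U" "?e \<in> F"
        by (auto simp: rooted_trees_def)
      have "crossed (F - {?e}) (U - {a})"
        unfolding crossed_def
      proof (intro allI impI)
        fix A assume A: "A \<subseteq> U - {a}" "A \<noteq> {}"
        then obtain f where f: "f \<in> F" "f \<inter> A \<noteq> {}" "\<not> f \<subseteq> A"
          using F(3) unfolding crossed_def by (meson Diff_subset order_trans)
        \<comment> \<open>Since \<open>A\<close> avoids both \<open>a\<close> and \<open>b\<close>,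
          the edge \<open>{a, b}\<close> does not meet \<open>A\<close> and cannot be the crossing
          edge.\<close>
        then have "f \<noteq> ?e" using A assms(6) by auto
        then show "\<exists>f\<in>F - {?e}. f \<inter> A \<noteq> {} \<and> \<not> f \<subseteq> A" using f by blast
      qed
      then show "F - {?e} \<in> rooted_trees E (U - {a})"
        using F fin[of F] assms(1,5) by (auto simp: rooted_trees_def)
    qed
  qed
  then have "card {F \<in> rooted_trees E U. ?e \<in> F} = card (rooted_trees E (U - {a}))"
    by (simp add: bij_betw_same_card)
  moreover have "{F \<in> rooted_trees E U. ?e \<notin> F} = rooted_trees (E - {?e}) U"
    by (auto simp: rooted_trees_def)
  moreover have "card ({F \<in> rooted_trees E U. ?e \<notin> F} \<union> {F \<in> rooted_trees E U. ?e \<in> F}) =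
    card {F \<in> rooted_trees E U. ?e \<notin> F} + card {F \<in> rooted_trees E U. ?e \<in> F}"
    using finite_rooted_trees[OF assms(2), of U] by (intro card_Un_disjoint) auto
  moreover have "rooted_trees E U =
      {F \<in> rooted_trees E U. ?e \<notin> F} \<union> {F \<in> rooted_trees E U. ?e \<in> F}"
    by blast
  ultimately show ?thesis by simp
qed

text \<open>Deleting \<open>{a, b}\<close> lowers the degree of \<open>a\<close> by one and changes
  no other degree in \<open>U\<close> and no neighbour count inside \<open>U\<close>; this matches
  \<open>C a < ?m\<close>. If \<open>C a = ?m\<close>, then \<open>a\<close> can burn first, so only
  the condition on \<open>U - {a}\<close> remains.\<close>

lemma card_burnable_configs_rec:
  assumes "finite U" "finite E" "\<forall>e\<in>E. card e = 2" "{a, b} \<in> E" "a \<in> U" "b \<notin> U"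
  shows "card (burnable_configs E U) =
    card (burnable_configs (E - {{a, b}}) U) + card (burnable_configs E (U - {a}))"
proof -
  let ?m = "degree E a - 1"
  let ?E = "E - {{a, b}}"
  have b: "b \<in> nbrs E a" using assms(4) by (simp add: nbrs_def insert_commute)
  have pos: "degree E a > 0"
    using b finite_nbrs[OF assms(2)] by (auto simp: degree_def card_gt_0_iff)
  have "nbrs ?E a = nbrs E a - {b}"
    by (auto simp: nbrs_def doubleton_eq_iff)
  then have deg_a: "degree ?E a = ?m"
    using b finite_nbrs[OF assms(2)] by (simp add: degree_def)
  have "nbrs ?E v = nbrs E v" if "v \<in> U" "v \<noteq> a" for v
    using that assms(6) by (auto simp: nbrs_def doubleton_eq_iff)
  then have deg_v: "degree ?E v = degree E v" if "v \<in> U" "v \<noteq> a" for v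
    using that by (simp add: degree_def)
  have nA: "nbrs ?E v \<inter> A = nbrs E v \<inter> A" if "v \<in> A" "A \<subseteq> U" for v A
    using that assms(6) by (auto simp: nbrs_def doubleton_eq_iff)
  then have "burnable ?E U C = burnable E U C" for C
    unfolding burnable_def by (metis (no_types, lifting))
  moreover have "(\<forall>v\<in>U. C v < degree ?E v) \<longleftrightarrow> (\<forall>v\<in>U. C v < degree E v) \<and> C a < ?m" for C
    using deg_a deg_v assms(5) by fastforce
  ultimately have del: "{C \<in> burnable_configs E U. C a < ?m} = burnable_configs ?E U"
    by (auto simp: burnable_configs_def)
  have "bij_betw (\<lambda>C. C(a := ?m)) (burnable_configs E (U - {a})) {C \<in> burnable_configs E U. C a = ?m}"
  \<comment> \<open>Configurations on \<open>U - {a}\<close> are extensional, so forgetting the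
    chips at \<open>a\<close> means resetting that value to \<open>undefined\<close>.\<close>
  proof (rule bij_betw_byWitness[where f' = "\<lambda>C. C(a := undefined)"])
    show "\<forall>C\<in>burnable_configs E (U - {a}). (C(a := ?m))(a := undefined) = C"
      by (auto simp: burnable_configs_def configs_def fun_eq_iff PiE_iff extensional_def)
    show "\<forall>C\<in>{C \<in> burnable_configs E U. C a = ?m}. (C(a := undefined))(a := ?m) = C"
      by (auto simp: fun_eq_iff)
    show "(\<lambda>C. C(a := ?m)) ` burnable_configs E (U - {a}) \<subseteq> {C \<in> burnable_configs E U. C a = ?m}"
    proof (rule image_subsetI)
      fix C assume "C \<in> burnable_configs E (U - {a})"
      then have C: "C \<in> configs (U - {a})" "\<forall>v\<in>U - {a}. C v < degree E v" "burnable E (U - {a}) C"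
        by (auto simp: burnable_configs_def)
      have "burnable E U (C(a := ?m))"
        unfolding burnable_def
      proof (intro allI impI)
        fix A assume A: "A \<subseteq> U" "A \<noteq> {}"
        show "\<exists>v\<in>A. card (nbrs E v \<inter> A) \<le> (C(a := ?m)) v"
        proof (cases "a \<in> A")
          case True
          \<comment> \<open>The neighbour \<open>b\<close> lies outside \<open>U\<close>, so
            \<open>a\<close> has at most \<open>?m\<close> neighbours in any \<open>A\<close> and
            satisfies the burning condition itself.\<close>
          have "nbrs E a \<inter> A \<subseteq> nbrs E a - {b}" using A assms(6) by auto
          then have "card (nbrs E a \<inter> A) \<le> card (nbrs E a - {b})"
            using finite_nbrs[OF assms(2)] by (intro card_mono) auto
          then have "card (nbrs E a \<inter> A) \<le> ?m"
            using b by (simp add: degree_def)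
          then show ?thesis using True by force
        next
          case False
          then obtain v where "v \<in> A" "card (nbrs E v \<inter> A) \<le> C v"
            using burnableD[OF C(3), of A] A by blast
          then show ?thesis using False by force
        qed
      qed
      then show "C(a := ?m) \<in> {C \<in> burnable_configs E U. C a = ?m}"
        using C pos assms(5) by (auto simp: burnable_configs_def configs_def PiE_iff extensional_def)
    qed
    show "(\<lambda>C. C(a := undefined)) ` {C \<in> burnable_configs E U. C a = ?m} \<subseteq> burnable_configs E (U - {a})"
    proof (rule image_subsetI)
      fix C assume "C \<in> {C \<in> burnable_configs E U. C a = ?m}"
      then have C: "C \<in> configs U" "\<forall>v\<in>U. C v < degree E v" "burnable E U C"
        by (auto simp: burnable_configs_def)
      have "burnable E (U - {a}) (C(a := undefined))"
        using burnable_subset[OF C(3), of "U - {a}"]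
          burnable_cong[of "U - {a}" C "C(a := undefined)" E] by auto
      then show "C(a := undefined) \<in> burnable_configs E (U - {a})"
        using C by (auto simp: burnable_configs_def configs_def PiE_iff extensional_def)
    qed
  qed
  then have contr: "card {C \<in> burnable_configs E U. C a = ?m} = card (burnable_configs E (U - {a}))"
    by (simp add: bij_betw_same_card)
  have "C a < ?m \<or> C a = ?m" if "C \<in> burnable_configs E U" for C
    using that assms(5) by (fastforce simp: burnable_configs_def)
  then have "burnable_configs E U =
      {C \<in> burnable_configs E U. C a < ?m} \<union> {C \<in> burnable_configs E U. C a = ?m}"
    by blast
  moreover have "card ({C \<in> burnable_configs E U. C a < ?m} \<union> {C \<in> burnable_configs E U. C a = ?m}) =
      card {C \<in> burnable_configs E U. C a < ?m} + card {C \<in> burnable_configs E U. C a = ?m}"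
    using finite_burnable_configs[OF assms(1), of E] by (intro card_Un_disjoint) auto
  ultimately show ?thesis using del contr by simp
qed

text \<open>Deletion lowers \<open>card E\<close> and contraction lowers \<open>card U\<close>,
  hence the induction measure. If no edge leaves a nonempty \<open>U\<close>, both sides are zero:
  \<open>U\<close> is not crossed, and burning some \<open>v\<close> would require all
  \<open>degree E v\<close> chips.\<close>

lemma card_burnable_configs_eq_rooted_trees:
  assumes "finite U" "finite E" "\<forall>e\<in>E. card e = 2"
  shows "card (burnable_configs E U) = card (rooted_trees E U)"
  using assms
proof (induction "card U + card E" arbitrary: U E rule: less_induct)
  case less
  consider "U = {}" | "U \<noteq> {}" "\<nexists>e. e \<in> E \<and> e \<inter> U \<noteq> {} \<and> \<not> e \<subseteq> U"
    | e where "e \<in> E" "e \<inter> U \<noteq> {}" "\<not> e \<subseteq> U" by blast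
  then show ?case
  proof cases
    case 1
    have "burnable_configs E {} = {\<lambda>_. undefined}"
      by (auto simp: burnable_configs_def configs_def burnable_def)
    moreover have "F = {}" if "F \<subseteq> E" "card F = 0" for F
      using that finite_subset[OF that(1) less.prems(2)] by simp
    then have "rooted_trees E {} = {{}}"
      by (auto simp: rooted_trees_def crossed_def)
    ultimately show ?thesis using 1 by simp
  next
    case 2
    have "rooted_trees E U = {}"
      using 2 unfolding rooted_trees_def crossed_def by blast
    moreover have "burnable_configs E U = {}"
    proof (rule ccontr)
      assume "burnable_configs E U \<noteq> {}"
      then obtain C where C: "\<forall>v\<in>U. C v < degree E v" "burnable E U C"
        by (auto simp: burnable_configs_def)
      then obtain v where v: "v \<in> U" "card (nbrs E v \<inter> U) \<le> C v"
        using burnableD[OF C(2), of U] 2(1) by blast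
      have "nbrs E v \<subseteq> U" using 2(2) v(1) by (auto simp: nbrs_def)
      then have "nbrs E v \<inter> U = nbrs E v" by blast
      then have "degree E v \<le> C v" using v(2) by (simp add: degree_def)
      then show False using C(1) v(1) by (meson leD)
    qed
    ultimately show ?thesis by simp
  next
    case (3 e)
    then obtain a b where ab: "e = {a, b}" "a \<in> U" "b \<notin> U"
      using crossing_edge less.prems(3) by metis
    have cU: "card (U - {a}) < card U" and cE: "card (E - {e}) < card E"
      using card_Diff1_less less.prems(1,2) ab(2) 3(1) by metis+
    have "card (burnable_configs (E - {e}) U) = card (rooted_trees (E - {e}) U)"
      using less.prems cE by (intro less.hyps) auto
    moreover have "card (burnable_configs E (U - {a})) = card (rooted_trees E (U - {a}))"
      using less.prems cU by (intro less.hyps) auto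
    ultimately show ?thesis
      using card_burnable_configs_rec[OF less.prems, of a b]
        card_rooted_trees_rec[OF less.prems, of a b] 3(1) ab by simp
  qed
qed

section \<open>Spanning trees\<close>

lemma rtranclp_distinct_path:
  assumes "r\<^sup>*\<^sup>* u v"
  shows "\<exists>xs. xs \<noteq> [] \<and> hd xs = u \<and> last xs = v \<and> distinct xs \<and> successively r xs"
  using assms
proof (induction rule: rtranclp_induct)
  case base
  show ?case by (intro exI[of _ "[u]"]) simp
next
  case (step v w)
  then obtain xs where xs: "xs \<noteq> []" "hd xs = u" "last xs = v" "distinct xs" "successively r xs"
    by blast
  show ?case
  proof (cases "w \<in> set xs")
    case True
    then obtain ys zs where "xs = ys @ w # zs" by (auto simp: in_set_conv_decomp)
    \<comment> \<open>When \<open>w\<close> already lies on the path, the path is cut back to end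
      there.\<close>
    then show ?thesis using xs
      by (intro exI[of _ "ys @ [w]"]) (auto simp: successively_append_iff hd_append)
  next
    case False
    then show ?thesis using xs step(2)
      by (intro exI[of _ "xs @ [w]"]) (auto simp: successively_append_iff)
  qed
qed

text \<open>An edge leaving the set of vertices unreachable from \<open>r\<close> would make one of
  them reachable.\<close>

lemma crossed_imp_connected:
  assumes "\<forall>e\<in>T. e \<subseteq> W \<and> card e = 2" "r \<in> W" "crossed T (W - {r})"
  shows "connected_graph W T"
proof -
  let ?R = "\<lambda>x y. {x, y} \<in> T"
  have sym: "?R\<^sup>*\<^sup>* y x" if "?R\<^sup>*\<^sup>* x y" for x y
    using that
  proof (induction)
    case (step y z)
    have "{z, y} \<in> T" using step(2) by (simp add: insert_commute)
    then show ?case using step(3) by (rule converse_rtranclp_into_rtranclp)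
  qed simp
  have reach: "?R\<^sup>*\<^sup>* r v" if "v \<in> W" for v
  proof (rule ccontr)
    assume v: "\<not> ?R\<^sup>*\<^sup>* r v"
    define A where "A = {x \<in> W. \<not> ?R\<^sup>*\<^sup>* r x}"
    have "A \<subseteq> W - {r}" "A \<noteq> {}" using v that by (auto simp: A_def)
    then obtain e where e: "e \<in> T" "e \<inter> A \<noteq> {}" "\<not> e \<subseteq> A"
      using assms(3) unfolding crossed_def by blast
    then obtain a b where ab: "e = {a, b}" "a \<in> A" "b \<notin> A"
      using crossing_edge assms(1) by metis
    then have "?R\<^sup>*\<^sup>* r b" using assms(1) e(1) by (auto simp: A_def)
    moreover have "?R b a" using e(1) ab by (simp add: insert_commute)
    ultimately have "?R\<^sup>*\<^sup>* r a" by (rule rtranclp.rtrancl_into_rtrancl)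
    then show False using ab by (simp add: A_def)
  qed
  then show ?thesis using assms(2) sym
    unfolding connected_graph_def by (metis (no_types, lifting) empty_iff rtranclp_trans)
qed

text \<open>The position of the crossing pair is recorded so that, on a cycle, it can be told apart
  from the closing edge.\<close>

lemma successively_exit:
  assumes "successively r xs" "xs \<noteq> []" "hd xs \<in> A \<longleftrightarrow> last xs \<notin> A"
  shows "\<exists>x y. r x y \<and> (x \<in> A \<longleftrightarrow> y \<notin> A) \<and> (\<exists>ys zs. xs = ys @ x # y # zs)"
  using assms
proof (induction xs)
  case (Cons x xs)
  then obtain y zs where xs: "xs = y # zs" by (cases xs) auto
  show ?case
  proof (cases "x \<in> A \<longleftrightarrow> y \<notin> A")
    case True
    then show ?thesis using Cons.prems xs by (metis append_Nil successively.simps(3))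
  next
    case False
    then have "\<exists>x y. r x y \<and> (x \<in> A \<longleftrightarrow> y \<notin> A) \<and> (\<exists>ys zs. xs = ys @ x # y # zs)"
      using Cons.prems xs by (intro Cons.IH) auto
    then show ?thesis by (metis append_Cons)
  qed
qed simp

lemma connected_imp_crossed:
  assumes "connected_graph W T" "r \<in> W"
  shows "crossed T (W - {r})"
  unfolding crossed_def
proof (intro allI impI)
  fix A assume A: "A \<subseteq> W - {r}" "A \<noteq> {}"
  then obtain v where v: "v \<in> A" by blast
  then have "(\<lambda>x y. {x, y} \<in> T)\<^sup>*\<^sup>* v r"
    using assms A unfolding connected_graph_def by blast
  from rtranclp_distinct_path[OF this] obtain xs
    where "xs \<noteq> []" "hd xs = v" "last xs = r" "successively (\<lambda>x y. {x, y} \<in> T) xs" by blast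
  then obtain x y where "{x, y} \<in> T" "x \<in> A \<longleftrightarrow> y \<notin> A"
    using successively_exit[of "\<lambda>x y. {x, y} \<in> T" xs A] v A by blast
  then show "\<exists>e\<in>T. e \<inter> A \<noteq> {} \<and> \<not> e \<subseteq> A" by (intro bexI[of _ "{x, y}"]) auto
qed

text \<open>A cycle crosses any cut more than once: if the closing edge crosses \<open>A\<close>,
  the path formed by the rest of the cycle changes sides too.\<close>

lemma crossed_remove_cycle_edge:
  assumes "\<forall>e\<in>T. card e = 2" "crossed T U" "is_cycle T xs"
  shows "crossed (T - {{last xs, hd xs}}) U"
  unfolding crossed_def
proof (intro allI impI)
  let ?e = "{last xs, hd xs}"
  fix A assume A: "A \<subseteq> U" "A \<noteq> {}"
  then obtain f where f: "f \<in> T" "f \<inter> A \<noteq> {}" "\<not> f \<subseteq> A"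
    using crossedE[OF assms(2)] by metis
  show "\<exists>e\<in>T - {?e}. e \<inter> A \<noteq> {} \<and> \<not> e \<subseteq> A"
  proof (cases "f = ?e")
    case True
    have xs: "3 \<le> length xs" "distinct xs" "successively (\<lambda>x y. {x, y} \<in> T) xs"
      using assms(3) by (auto simp: is_cycle_def)
    have "hd xs \<in> A \<longleftrightarrow> last xs \<notin> A" using f(2,3) True by (cases "hd xs \<in> A") simp_all
    moreover have "xs \<noteq> []" using xs(1) by auto
    ultimately obtain x y ys zs
      where xy: "{x, y} \<in> T" "x \<in> A \<longleftrightarrow> y \<notin> A" "xs = ys @ x # y # zs"
      using successively_exit[OF xs(3), of A] by metis
    \<comment> \<open>If \<open>x\<close> were the last vertex, it would recur after its own
      position. If instead \<open>x\<close> is first and \<open>y\<close> last, distinctness leaves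
      only two vertices, against the length bound.\<close>
    have "{x, y} \<noteq> ?e"
    proof
      assume "{x, y} = ?e"
      then consider "x = last xs" | "x = hd xs" "y = last xs"
        unfolding doubleton_eq_iff by blast
      then show False
      proof cases
        case 1
        have "last xs \<in> set (y # zs)" using xy(3) last_in_set[of "y # zs"] by simp
        then show False using xs(2) xy(3) unfolding 1[symmetric] by simp
      next
        case 2
        have "ys = []"
        proof (rule ccontr)
          assume "ys \<noteq> []"
          then have "hd xs \<in> set ys" using xy(3) by simp
          then show False using xs(2) xy(3) unfolding 2(1)[symmetric] by simp
        qed
        moreover have "zs = []"
        proof (rule ccontr)
          assume "zs \<noteq> []"
          then have "last xs \<in> set zs" using xy(3) by simp
          then show False using xs(2) xy(3) unfolding 2(2)[symmetric] by simp
        qed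
        ultimately show False using xs(1) xy(3) by simp
      qed
    qed
    then have "{x, y} \<in> T - {?e}" using xy(1) by blast
    moreover have "{x, y} \<inter> A \<noteq> {}" "\<not> {x, y} \<subseteq> A" using xy(2) by (cases "x \<in> A"; simp)+
    ultimately show ?thesis by (intro bexI conjI)
  next
    case False
    then have "f \<in> T - {?e}" using f(1) by simp
    then show ?thesis using f(2,3) by (intro bexI conjI)
  qed
qed

text \<open>In a tree \<open>T\<close>, a crossing subset \<open>F\<close> with the right number of
  edges already connects \<open>W\<close>, so an edge of \<open>T\<close> outside \<open>F\<close>
  would close a cycle. Conversely, dropping a cycle edge would keep the crossing property with too
  few edges.\<close>

lemma is_tree_iff_rooted:
  assumes "finite W" "r \<in> W" "simple_graph W T"
  shows "is_tree W T \<longleftrightarrow> card T = card (W - {r}) \<and> crossed T (W - {r})"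
proof -
  let ?U = "W - {r}"
  have T: "\<forall>e\<in>T. e \<subseteq> W \<and> card e = 2" using assms(3) by (simp add: simple_graph_def)
  then have T2: "\<forall>e\<in>T. card e = 2" by blast
  have "T \<subseteq> Pow W" using T by blast
  then have finT: "finite T" using assms(1) finite_subset by blast
  show ?thesis
  proof
    assume tree: "is_tree W T"
    then have cr: "crossed T ?U"
      using connected_imp_crossed assms(2) by (auto simp: is_tree_def)
    obtain F where F: "F \<subseteq> T" "card F = card ?U" "crossed F ?U"
      using crossed_obtain_tree[OF _ finT T2 cr] assms(1) by blast
    have "T \<subseteq> F"
    proof
      fix e assume e: "e \<in> T"
      show "e \<in> F"
      proof (rule ccontr)
        assume eF: "e \<notin> F"
        obtain u v where uv: "e = {u, v}" "u \<noteq> v" using T2 e by (metis card_2_iff)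
        have "connected_graph W F"
          using T F crossed_imp_connected[of F W r] assms(2) by blast
        then have "(\<lambda>x y. {x, y} \<in> F)\<^sup>*\<^sup>* u v"
          using uv T e by (auto simp: connected_graph_def)
        from rtranclp_distinct_path[OF this] obtain xs
          where xs: "xs \<noteq> []" "hd xs = u" "last xs = v" "distinct xs"
            "successively (\<lambda>x y. {x, y} \<in> F) xs" by blast
        \<comment> \<open>A path with one vertex would give \<open>u = v\<close>, and one with two
          vertices would put \<open>e\<close> into \<open>F\<close>.\<close>
        have "3 \<le> length xs"
        proof (rule ccontr)
          assume "\<not> 3 \<le> length xs"
          moreover have "length xs \<noteq> 0" using xs(1) by simp
          ultimately have "length xs = 1 \<or> length xs = 2" by linarith
          then show False using xs uv eF
            by (auto simp: length_Suc_conv numeral_2_eq_2)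
        qed
        moreover have "successively (\<lambda>x y. {x, y} \<in> T) xs"
          using xs(5) F(1) by (auto elim: successively_mono)
        ultimately have "is_cycle T xs"
          using xs e uv by (auto simp: is_cycle_def insert_commute)
        then show False using tree by (auto simp: is_tree_def)
      qed
    qed
    then show "card T = card ?U \<and> crossed T ?U" using F cr by auto
  next
    assume r: "card T = card ?U \<and> crossed T ?U"
    have "\<not> is_cycle T xs" for xs
    proof
      assume c: "is_cycle T xs"
      let ?e = "{last xs, hd xs}"
      have "card ?U \<le> card (T - {?e})"
        using crossed_card_le[of ?U "T - {?e}"] crossed_remove_cycle_edge[OF T2 _ c] r
          assms(1) finT T2 by auto
      moreover have "card (T - {?e}) < card T"
        using c finT by (intro card_Diff1_less) (auto simp: is_cycle_def)
      ultimately show False using r by simp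
    qed
    then show "is_tree W T"
      using crossed_imp_connected[OF T assms(2)] r assms(3) by (auto simp: is_tree_def)
  qed
qed

section \<open>Legality and burning\<close>

context
  fixes V :: "'a set" and E :: "'a set set"
  assumes graph: "finite_simple_graph V E"
begin

lemma finite_V: "finite V"
  using graph by (simp add: finite_simple_graph_def)

lemma edges: "\<forall>e\<in>E. e \<subseteq> V \<and> card e = 2"
  using graph by (simp add: finite_simple_graph_def simple_graph_def)

lemma finite_E: "finite E"
proof -
  have "E \<subseteq> Pow V" using edges by blast
  then show ?thesis using finite_V finite_subset by blast
qed

lemma nbrs_subset: "nbrs E v \<subseteq> V"
  using edges by (auto simp: nbrs_def)

lemma not_self_nbr: "v \<notin> nbrs E v"
  using edges by (auto simp: nbrs_def)

lemma nbrs_outside: "v \<notin> V \<Longrightarrow> nbrs E v = {}"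
  using edges by (auto simp: nbrs_def)

text \<open>If \<open>A\<close> is forbidden for \<open>C\<close>, then \<open>A - {v}\<close> is
  forbidden for \<open>D\<close>: when \<open>v\<close> is in \<open>A\<close>, each neighbour of
  \<open>v\<close> in \<open>A\<close> loses one chip and one neighbour in the set, and no other
  remaining vertex gains chips.\<close>

lemma reverse_step_not_burnable:
  assumes "reverse_step V E C D" "\<not> burnable E V C"
  shows "\<not> burnable E V D"
proof -
  obtain v where v: "v \<in> V" "\<forall>u\<in>nbrs E v. 1 \<le> C u" "D = reverse_fire E v C"
    using assms(1) by (auto simp: reverse_step_def can_reverse_fire_def)
  obtain A where A: "A \<subseteq> V" "A \<noteq> {}" "\<forall>u\<in>A. C u < card (nbrs E u \<inter> A)"
    using assms(2) by (auto simp: burnable_def not_le)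
  \<comment> \<open>A singleton is never forbidden: its vertex has no neighbour in it and would need
    a negative number of chips.\<close>
  have "\<exists>w\<in>A. w \<noteq> v"
  proof (rule ccontr)
    assume "\<not> ?thesis"
    then have "A = {v}" using A(2) by auto
    then show False using A(3) not_self_nbr by simp
  qed
  then have "A - {v} \<noteq> {}" by blast
  moreover have "D u < card (nbrs E u \<inter> (A - {v}))" if u: "u \<in> A - {v}" for u
  proof (cases "v \<in> A \<and> u \<in> nbrs E v")
    case True
    then have "nbrs E u \<inter> A = insert v (nbrs E u \<inter> (A - {v}))"
      by (auto simp: nbrs_sym[of v])
    then have "card (nbrs E u \<inter> A) = Suc (card (nbrs E u \<inter> (A - {v})))"
      using finite_nbrs[OF finite_E] by simp
    moreover have "D u = C u - 1" "1 \<le> C u" using True u v by (auto simp: reverse_fire_def)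
    moreover have "C u < card (nbrs E u \<inter> A)" using A(3) u by blast
    ultimately show ?thesis by linarith
  next
    case False
    then have "nbrs E u \<inter> A = nbrs E u \<inter> (A - {v})"
      by (auto simp: nbrs_sym[of v])
    moreover have "D u \<le> C u" using u v by (simp add: reverse_fire_def)
    moreover have "C u < card (nbrs E u \<inter> A)" using A(3) u by blast
    ultimately show ?thesis by simp
  qed
  ultimately show ?thesis
    using A(1) unfolding burnable_def by (metis Diff_subset leD order_trans)
qed

text \<open>A forbidden set persists under reverse-firing, but a supercritical configuration has
  none, as each vertex holds more chips than it has neighbours.\<close>

lemma legal_imp_burnable:
  assumes "legal V E C"
  shows "burnable E V C"
proof (rule ccontr)
  assume C: "\<not> burnable E V C"
  obtain D where D: "(reverse_step V E)\<^sup>*\<^sup>* C D" "supercritical V E D"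
    using assms by (auto simp: legal_def)
  from D(1) C have "\<not> burnable E V D"
    by (induction) (auto dest: reverse_step_not_burnable)
  then obtain A where A: "A \<subseteq> V" "A \<noteq> {}" "\<forall>u\<in>A. D u < card (nbrs E u \<inter> A)"
    by (auto simp: burnable_def not_le)
  then obtain u where u: "u \<in> A" by blast
  have "card (nbrs E u \<inter> A) \<le> degree E u"
    unfolding degree_def using finite_nbrs[OF finite_E] by (intro card_mono) auto
  moreover have "degree E u < D u" using D(2) A(1) u by (auto simp: supercritical_def)
  ultimately show False using A(3) u by fastforce
qed

text \<open>Each vertex of \<open>A\<close> is reverse-fired exactly once, in the opposite of a
  burning order: the vertex \<open>v\<close> that burns first goes last, since it can pay for all
  its neighbours in \<open>A\<close> from its original chips.\<close>

lemma reverse_fire_set: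
  assumes "finite A" "A \<subseteq> V" "burnable E A D" "\<forall>u. u \<notin> A \<longrightarrow> card (nbrs E u \<inter> A) \<le> D u"
  shows "(reverse_step V E)\<^sup>*\<^sup>* D
    (\<lambda>u. D u + (if u \<in> A then degree E u + 1 else 0) - card (nbrs E u \<inter> A))"
  using assms
proof (induction A rule: finite_psubset_induct)
  case (psubset A)
  show ?case
  proof (cases "A = {}")
    case True
    then show ?thesis by simp
  next
    case False
    let ?D = "\<lambda>A u. D u + (if u \<in> A then degree E u + 1 else 0) - card (nbrs E u \<inter> A)"
    obtain v where v: "v \<in> A" "card (nbrs E v \<inter> A) \<le> D v"
      using burnableD[OF psubset.prems(2), of A] False by blast
    have le: "card (nbrs E u \<inter> (A - {v})) \<le> card (nbrs E u \<inter> A)" for u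
      using finite_nbrs[OF finite_E] by (intro card_mono) auto
    have le_deg: "card (nbrs E u \<inter> A) \<le> degree E u" for u
      unfolding degree_def using finite_nbrs[OF finite_E] by (intro card_mono) auto
    have enough: "card (nbrs E u \<inter> (A - {v})) \<le> D u" if "u \<notin> A - {v}" for u
      using that v(2) psubset.prems(3) le[of u] by (cases "u = v") (auto intro: order_trans)
    then have IH: "(reverse_step V E)\<^sup>*\<^sup>* D (?D (A - {v}))"
      using v psubset.prems burnable_subset[OF psubset.prems(2), of "A - {v}"]
      by (intro psubset.IH) auto
    have nb: "card (nbrs E u \<inter> A) = Suc (card (nbrs E u \<inter> (A - {v})))" if "u \<in> nbrs E v" for u
    proof -
      have "nbrs E u \<inter> A = insert v (nbrs E u \<inter> (A - {v}))"
        using that v by (auto simp: nbrs_sym[of u])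
      then show ?thesis using finite_nbrs[OF finite_E] by simp
    qed
    have non_nb: "nbrs E u \<inter> A = nbrs E u \<inter> (A - {v})" if "u \<notin> nbrs E v" for u
      using that v by (auto simp: nbrs_sym[of u])
    have "can_reverse_fire E (?D (A - {v})) v"
      unfolding can_reverse_fire_def
    proof
      fix u assume u: "u \<in> nbrs E v"
      then have "u \<noteq> v" using not_self_nbr by blast
      \<comment> \<open>A neighbour in \<open>A\<close> has already gained one chip more than its
        degree; one outside \<open>A\<close> still holds the chip reserved for \<open>v\<close> by
        the hypothesis.\<close>
      then show "1 \<le> ?D (A - {v}) u"
        using nb[OF u] psubset.prems(3) le_deg[of u] by (cases "u \<in> A") (auto simp: Suc_le_eq)
    qed
    moreover have "?D A = reverse_fire E v (?D (A - {v}))"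
    proof
      fix u
      consider "u = v" | "u \<noteq> v" "u \<in> nbrs E v" | "u \<noteq> v" "u \<notin> nbrs E v" by blast
      then show "?D A u = reverse_fire E v (?D (A - {v})) u"
      proof cases
        case 1
        \<comment> \<open>Subtraction is truncated, so adding the chips of \<open>v\<close> before
          or after subtracting agrees thanks to the bound \<open>enough\<close>.\<close>
        then show ?thesis using v enough[of v] non_nb[of v] not_self_nbr[of v]
          by (simp add: reverse_fire_def)
      next
        case 2
        then show ?thesis using nb[of u] by (simp add: reverse_fire_def)
      next
        case 3
        then show ?thesis using non_nb[of u] by (simp add: reverse_fire_def)
      qed
    qed
    ultimately have "reverse_step V E (?D (A - {v})) (?D A)"
      using v psubset.prems(1) unfolding reverse_step_def by blast
    then show ?thesis using IH by (rule rtranclp.rtrancl_into_rtrancl[rotated])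
  qed
qed

text \<open>Reverse-firing every vertex once adds one chip everywhere, and this can be repeated.\<close>

lemma burnable_add:
  assumes "burnable E V C"
  shows "(reverse_step V E)\<^sup>*\<^sup>* C (\<lambda>u. if u \<in> V then C u + n else C u)"
proof (induction n)
  case 0
  have "(\<lambda>u. if u \<in> V then C u + 0 else C u) = C" by auto
  then show ?case by simp
next
  case (Suc n)
  let ?D = "\<lambda>u. if u \<in> V then C u + n else C u"
  have "burnable E V ?D"
    unfolding burnable_def
  proof (intro allI impI)
    fix A assume A: "A \<subseteq> V" "A \<noteq> {}"
    then obtain v where "v \<in> A" "card (nbrs E v \<inter> A) \<le> C v" using burnableD[OF assms] by blast
    then show "\<exists>v\<in>A. card (nbrs E v \<inter> A) \<le> ?D v" using A by (intro bexI[of _ v]) auto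
  qed
  then have "(reverse_step V E)\<^sup>*\<^sup>* ?D
      (\<lambda>u. ?D u + (if u \<in> V then degree E u + 1 else 0) - card (nbrs E u \<inter> V))"
    using finite_V nbrs_outside by (intro reverse_fire_set) auto
  \<comment> \<open>Every vertex of \<open>V\<close> gains its degree plus one and pays its degree;
    vertices outside \<open>V\<close> have no neighbours.\<close>
  moreover have "(\<lambda>u. ?D u + (if u \<in> V then degree E u + 1 else 0) - card (nbrs E u \<inter> V)) =
      (\<lambda>u. if u \<in> V then C u + Suc n else C u)"
    using nbrs_outside nbrs_subset by (auto simp: fun_eq_iff degree_def Int_absorb2)
  ultimately show ?case using rtranclp_trans[OF Suc.IH] by simp
qed

lemma legal_iff_burnable: "legal V E C \<longleftrightarrow> burnable E V C"
proof
  assume C: "burnable E V C"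
  \<comment> \<open>This number exceeds every degree.\<close>
  let ?n = "Suc (\<Sum>v\<in>V. degree E v)"
  have "supercritical V E (\<lambda>u. if u \<in> V then C u + ?n else C u)"
    unfolding supercritical_def
  proof
    fix v assume v: "v \<in> V"
    then have "degree E v \<le> (\<Sum>v\<in>V. degree E v)"
      using finite_V by (intro member_le_sum) auto
    then show "degree E v < (if v \<in> V then C v + ?n else C v)" using v by simp
  qed
  then show "legal V E C"
    using burnable_add[OF C] unfolding legal_def by blast
qed (rule legal_imp_burnable)

section \<open>The cone\<close>

lemma nbrs_cone:
  assumes "v \<in> V"
  shows "nbrs (cone_edges V E) (Some v) = insert None (Some ` nbrs E v)"
proof -
  have 1: "{Some x, Some y} = Some ` e \<longleftrightarrow> e = {x, y}" for x y :: 'a and e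
    using inj_image_eq_iff[of Some "{x, y}" e] by auto
  have 2: "{None, Some v} \<noteq> Some ` e" for e :: "'a set" by auto
  have "u \<in> nbrs (cone_edges V E) (Some v) \<longleftrightarrow> u \<in> insert None (Some ` nbrs E v)" for u
  proof (cases u)
    case None
    then show ?thesis using assms by (auto simp: nbrs_def cone_edges_def)
  next
    case (Some x)
    then show ?thesis using 1[of x v] by (auto simp: nbrs_def cone_edges_def image_iff)
  qed
  then show ?thesis by blast
qed

text \<open>The edge to the apex turns the relaxed bound, at most the degree in the graph, into
  strictly below the degree in the cone.\<close>

lemma degree_cone: "v \<in> V \<Longrightarrow> degree (cone_edges V E) (Some v) = Suc (degree E v)"
  using finite_nbrs[OF finite_E]
  by (simp add: degree_def nbrs_cone card_image)

lemma simple_graph_cone: "simple_graph (cone_verts V) (cone_edges V E)"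
  using edges by (auto simp: simple_graph_def cone_verts_def cone_edges_def card_image)

lemma burnable_cone: "burnable (cone_edges V E) (Some ` V) C \<longleftrightarrow> burnable E V (C \<circ> Some)"
proof -
  have "card (nbrs (cone_edges V E) (Some v) \<inter> Some ` A) = card (nbrs E v \<inter> A)"
    if "v \<in> V" for v A
  proof -
    have "nbrs (cone_edges V E) (Some v) \<inter> Some ` A = Some ` (nbrs E v \<inter> A)"
      using that by (auto simp: nbrs_cone)
    then show ?thesis by (simp add: card_image)
  qed
  then show ?thesis
    unfolding burnable_def all_subset_image by (auto simp: subset_iff)
qed

lemma card_relaxed_legal_configs:
  "card (relaxed_legal_configs V E) = card (burnable_configs (cone_edges V E) (Some ` V))"
proof -
  have "bij_betw (\<lambda>C. restrict (C \<circ> Some) V)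
      (burnable_configs (cone_edges V E) (Some ` V)) (relaxed_legal_configs V E)"
  \<comment> \<open>Both maps rename vertices along \<open>Some\<close>; \<open>restrict\<close>
    resets values off the domain to \<open>undefined\<close>, which makes them exact
    inverses.\<close>
  proof (rule bij_betw_byWitness[where f' = "\<lambda>C. restrict (C \<circ> the) (Some ` V)"])
    show "\<forall>C\<in>burnable_configs (cone_edges V E) (Some ` V).
        restrict (restrict (C \<circ> Some) V \<circ> the) (Some ` V) = C"
      by (auto simp: burnable_configs_def configs_def fun_eq_iff PiE_iff extensional_def restrict_def)
    show "\<forall>C\<in>relaxed_legal_configs V E. restrict (restrict (C \<circ> the) (Some ` V) \<circ> Some) V = C"
      by (auto simp: relaxed_legal_configs_def configs_def fun_eq_iff PiE_iff extensional_def
          restrict_def)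
    show "(\<lambda>C. restrict (C \<circ> Some) V) ` burnable_configs (cone_edges V E) (Some ` V)
        \<subseteq> relaxed_legal_configs V E"
    proof (rule image_subsetI)
      fix C assume C: "C \<in> burnable_configs (cone_edges V E) (Some ` V)"
      then have "burnable E V (C \<circ> Some)" by (simp add: burnable_configs_def burnable_cone)
      then have "burnable E V (restrict (C \<circ> Some) V)"
        using burnable_cong[of V "C \<circ> Some" "restrict (C \<circ> Some) V" E] by simp
      then show "restrict (C \<circ> Some) V \<in> relaxed_legal_configs V E"
        using C by (auto simp: relaxed_legal_configs_def configs_def relaxed_def can_fire_def
            legal_iff_burnable burnable_configs_def degree_cone)
    qed
    show "(\<lambda>C. restrict (C \<circ> the) (Some ` V)) ` relaxed_legal_configs V E
        \<subseteq> burnable_configs (cone_edges V E) (Some ` V)"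
    proof (rule image_subsetI)
      fix C assume C: "C \<in> relaxed_legal_configs V E"
      then have "burnable E V C" by (simp add: relaxed_legal_configs_def legal_iff_burnable)
      then have "burnable E V (restrict (C \<circ> the) (Some ` V) \<circ> Some)"
        using burnable_cong[of V C "restrict (C \<circ> the) (Some ` V) \<circ> Some" E] by simp
      then show "restrict (C \<circ> the) (Some ` V) \<in> burnable_configs (cone_edges V E) (Some ` V)"
        using C by (auto simp: relaxed_legal_configs_def configs_def relaxed_def can_fire_def
            burnable_configs_def degree_cone burnable_cone)
    qed
  qed
  then show ?thesis by (simp add: bij_betw_same_card)
qed

lemma spanning_trees_cone:
  "spanning_trees (cone_verts V) (cone_edges V E) = rooted_trees (cone_edges V E) (Some ` V)"
proof -
  have "cone_verts V - {None} = Some ` V" by (auto simp: cone_verts_def)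
  moreover have "finite (cone_verts V)" "None \<in> cone_verts V"
    using finite_V by (auto simp: cone_verts_def)
  moreover have "simple_graph (cone_verts V) T" if "T \<subseteq> cone_edges V E" for T
    using that simple_graph_cone by (auto simp: simple_graph_def)
  ultimately show ?thesis
    using is_tree_iff_rooted[of "cone_verts V" None]
    by (auto simp: spanning_trees_def rooted_trees_def)
qed

end

theorem theorem3p1:
  fixes V :: "'a set" and E :: "'a set set"
  assumes "finite_simple_graph V E"
  shows "card (relaxed_legal_configs V E) =
         num_spanning_trees (cone_verts V) (cone_edges V E)"
proof -
  have "finite (cone_edges V E)"
    using finite_V[OF assms] finite_E[OF assms] by (simp add: cone_edges_def)
  moreover have "\<forall>e\<in>cone_edges V E. card e = 2"
    using simple_graph_cone[OF assms] by (simp add: simple_graph_def)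
  ultimately have "card (burnable_configs (cone_edges V E) (Some ` V)) =
      card (rooted_trees (cone_edges V E) (Some ` V))"
    using finite_V[OF assms] by (intro card_burnable_configs_eq_rooted_trees) auto
  then show ?thesis
    by (simp add: num_spanning_trees_def card_relaxed_legal_configs[OF assms]
        spanning_trees_cone[OF assms])
qed

end
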